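(* For every positive integer $n$, $$C_n(x)=\sum_{T\in\operatorname{SYT}(n)}\left(\prod_{i=1}^n\sigma_i(T)\,(i!)^{w_i(T)}\right)x^{n+1-\ell(\lambda(T))}.$$
   Context: $\mathcal{Q}_n$ is the set of Stirling permutations of $\{1,1,\ldots,n,n\}$ (words using each of $1,\ldots,n$ twice such that all letters between the two occurrences of $i$ are $\geqslant i$); with $\sigma_0=\sigma_{2n+1}=0$, ${\rm des}(\sigma)=\#\{i\in\{0,\ldots,2n\}:\sigma_i>\sigma_{i+1}\}$ and $C_n(x)=\sum_{\sigma\in\mathcal{Q}_n}x^{{\rm des}(\sigma)}$. $\operatorname{SYT}(n)$ is the set of standard Young tableaux with $n$ boxes (French convention). $\ell(\lambda(T))$ is the number of rows of $T$ and $w_i(T)$ the number of rows with exactly $i$ boxes. For $1\leqslant i\leqslant n$, $T_i$ is obtained from $T$ by deleting entries $i+1,\ldots,n$, and $\operatorname{col}_k(T_i)$ is the size of its $k$-th column; $\sigma_i(T)=i-\operatorname{col}_1(T_i)+1$ if $i$ lies in the first column of $T$, and $\sigma_i(T)=\operatorname{col}_k(T_i)-\operatorname{col}_{k+1}(T_i)+1$ if $i$ lies in the $(k+1)$-th column, $k\geqslant1$. *)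

theory Defs
  imports
    "HOL-Computational_Algebra.Polynomial"
    "HOL-Combinatorics.Multiset_Permutations"
begin

section \<open>Stirling permutations\<close>

definition stirling_perms :: "nat \<Rightarrow> nat list set" where
  "stirling_perms n =
     {w \<in> permutations_of_multiset (mset_set {1..n} + mset_set {1..n}).
        \<forall>a b c. a < b \<and> b < c \<and> c < length w \<and> w ! a = w ! c \<longrightarrow> w ! b \<ge> w ! a}"

text \<open>Descents are counted in the word padded by a zero on both sides, so position 0 is
  never a descent, and the last position always is one for a nonempty word over
  the positive integers.\<close>

definition des :: "nat list \<Rightarrow> nat" where
  "des w = (let v = [0] @ w @ [0] in card {i \<in> {0..length w}. v ! i > v ! (i + 1)})"

definition C_poly :: "nat \<Rightarrow> int poly" where
  "C_poly n = (\<Sum>w\<in>stirling_perms n. monom 1 (des w))"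


section \<open>Standard Young tableaux\<close>

text \<open>A tableau is the list of its rows; in the French convention these are listed from
  bottom to top, each row being read from left to right. Columns are numbered from 1,
  and each column is likewise read from bottom to top.\<close>

type_synonym tableau = "nat list list"

definition column :: "nat \<Rightarrow> tableau \<Rightarrow> nat list" where
  "column k T = map (\<lambda>r. r ! (k - 1)) (filter (\<lambda>r. k \<le> length r) T)"

definition shape :: "tableau \<Rightarrow> nat list" where
  "shape T = map length T"

definition SYT :: "nat \<Rightarrow> tableau set" where
  "SYT n =
     {T. (\<forall>r\<in>set T. r \<noteq> []) \<and>
         sorted_wrt (\<ge>) (shape T) \<and>
         distinct (concat T) \<and> set (concat T) = {1..n} \<and>
         (\<forall>r\<in>set T. sorted_wrt (<) r) \<and>
         (\<forall>k\<ge>1. sorted_wrt (<) (column k T))}"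

definition col :: "nat \<Rightarrow> tableau \<Rightarrow> nat" where
  "col k T = length (column k T)"

definition w_rows :: "nat \<Rightarrow> tableau \<Rightarrow> nat" where
  "w_rows i T = count_list (shape T) i"

text \<open>The tableau \<open>T\<^sub>i\<close>, obtained by deleting all entries greater than \<open>i\<close> (and the rows
  that become empty).\<close>

definition restrict_tab :: "nat \<Rightarrow> tableau \<Rightarrow> tableau" where
  "restrict_tab i T = filter (\<lambda>r. r \<noteq> []) (map (filter (\<lambda>e. e \<le> i)) T)"

definition col_of :: "tableau \<Rightarrow> nat \<Rightarrow> nat" where
  "col_of T i = (THE k. k \<ge> 1 \<and> i \<in> set (column k T))"

definition sigma :: "nat \<Rightarrow> tableau \<Rightarrow> int" where
  "sigma i T =
     (if col_of T i = 1 then int i - int (col 1 (restrict_tab i T)) + 1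
      else let k = col_of T i - 1
           in int (col k (restrict_tab i T)) - int (col (k + 1) (restrict_tab i T)) + 1)"

text \<open>\<open>sum\<close> over an infinite set is 0; the next two lemmas show that the index sets used here are finite.\<close>

lemma finite_stirling_perms: "finite (stirling_perms n)"
  by (simp add: stirling_perms_def)

lemma length_le_of_SYT:
  assumes "T \<in> SYT n"
  shows "length (concat T) = n" "length T \<le> n"
proof -
  show *: "length (concat T) = n"
    using assms distinct_card[of "concat T"] by (simp add: SYT_def)
  have "length T \<le> length (concat T)" if "\<forall>r\<in>set T. r \<noteq> []"
    using that
  proof (induction T)
    case (Cons a T)
    then have "length a \<ge> 1" by (cases a) auto
    then show ?case using Cons by simp
  qed simp
  then show "length T \<le> n" using assms * by (simp add: SYT_def)
qed

lemma finite_SYT: "finite (SYT n)"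
proof (rule finite_subset)
  let ?R = "{r :: nat list. set r \<subseteq> {1..n} \<and> length r \<le> n}"
  show "SYT n \<subseteq> {T. set T \<subseteq> ?R \<and> length T \<le> n}"
  proof (rule subsetI, rule CollectI, intro conjI subsetI CollectI)
    fix T r assume T: "T \<in> SYT n"
    show "length T \<le> n" using length_le_of_SYT[OF T] by simp
    assume r: "r \<in> set T"
    fix e assume "e \<in> set r"
    with r have "e \<in> set (concat T)" by auto
    moreover have "set (concat T) = {1..n}" using T unfolding SYT_def by blast
    ultimately show "e \<in> {1..n}" by blast
  next
    fix T r assume T: "T \<in> SYT n" and r: "r \<in> set T"
    have "length r \<le> length (concat T)"
      unfolding length_concat using r by (simp add: member_le_sum_list)
    then show "length r \<le> n" using length_le_of_SYT[OF T] by simp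
  qed
  show "finite {T. set T \<subseteq> ?R \<and> length T \<le> n}"
    by (intro finite_lists_length_le) simp
qed

end

theory Submission
  imports Defs
begin

text \<open>Both sides satisfy the recurrence \<open>q\<^sub>n\<^sub>+\<^sub>1 = (2n + 1) x q\<^sub>n + x (1 - x) q\<^sub>n'\<close>, whose right-hand
  side sends \<open>x\<^sup>p\<close> to \<open>p x\<^sup>p + (2n + 1 - p) x\<^sup>p\<^sup>+\<^sup>1\<close>. For Stirling permutations the new pair of largest
  letters enters any of the \<open>2n + 1\<close> gaps, and the number of descents stays the same exactly
  at the \<open>p\<close> descents. For a tableau with \<open>l\<close> rows, so \<open>p = n + 1 - l\<close>, a new row has weight
  \<open>n + 1 - l\<close>, and lengthening a row of length \<open>k\<close> has weight \<open>k + 1\<close> times the number of such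
  rows; over all \<open>k\<close> the latter add up to the number of boxes plus the number of rows, \<open>n + l\<close>.\<close>

section \<open>The recurrence operator of the second-order Eulerian polynomials\<close>

definition second_order_step :: "nat \<Rightarrow> int poly \<Rightarrow> int poly" where
  "second_order_step n q = monom (2 * int n + 1) 1 * q + (monom 1 1 - monom 1 2) * pderiv q"

text \<open>The term \<open>x * q'\<close> contributes \<open>p\<close> to the lower coefficient,
  and \<open>(2n + 1) * x * q - x^2 * q'\<close> contributes \<open>2n + 1 - p\<close> to the upper
  one. By linearity, both sides need matching on monomials only.\<close>

lemma second_order_step_monom:
  "second_order_step n (monom c p) =
     monom (c * int p) p + monom (c * (2 * int n + 1 - int p)) (Suc p)"
proof (cases p)
  case 0
  then show ?thesis
    by (simp add: second_order_step_def mult_monom pderiv_monom mult.commute)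
next
  case (Suc m)
  then show ?thesis
    by (simp add: second_order_step_def mult_monom pderiv_monom left_diff_distrib
        add_monom diff_monom numeral_2_eq_2 algebra_simps flip: monom_Suc)
qed

lemma second_order_step_sum: "second_order_step n (\<Sum>a\<in>A. f a) = (\<Sum>a\<in>A. second_order_step n (f a))"
  using higher_pderiv_sum[of 1 f A]
  by (simp add: second_order_step_def sum_distrib_left sum.distrib)


section \<open>Stirling permutations\<close>

text \<open>Gap \<open>j\<close> lies after the first \<open>j\<close> letters, so a word of length
  \<open>2 * n\<close> has the gaps \<open>0\<close> to \<open>2 * n\<close>.\<close>

definition insert_pair :: "'a \<Rightarrow> nat \<Rightarrow> 'a list \<Rightarrow> 'a list" where
  "insert_pair N j w = take j w @ [N, N] @ drop j w"

definition stirling_word :: "nat list \<Rightarrow> bool" where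
  "stirling_word w \<longleftrightarrow>
     (\<forall>a b c. a < b \<and> b < c \<and> c < length w \<and> w ! a = w ! c \<longrightarrow> w ! b \<ge> w ! a)"

lemma stirling_perms_iff:
  "w \<in> stirling_perms n \<longleftrightarrow> mset w = mset_set {1..n} + mset_set {1..n} \<and> stirling_word w"
  by (auto simp: stirling_perms_def stirling_word_def permutations_of_multiset_def)

lemma set_stirling_perm: "w \<in> stirling_perms n \<Longrightarrow> set w = {1..n}"
  by (metis stirling_perms_iff set_mset_mset set_mset_union finite_atLeastAtMost
      finite_set_mset_mset_set Un_absorb)

lemma length_stirling_perm: "w \<in> stirling_perms n \<Longrightarrow> length w = 2 * n"
proof -
  assume "w \<in> stirling_perms n"
  then have "size (mset w) = size (mset_set {1..n} + mset_set {1..n})"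
    by (simp only: stirling_perms_iff)
  then show ?thesis by simp
qed

lemma mset_insert_pair: "mset (insert_pair N j w) = mset w + {#N, N#}"
proof -
  have "mset w = mset (take j w) + mset (drop j w)"
    by (metis append_take_drop_id mset_append)
  then show ?thesis by (simp add: insert_pair_def)
qed

lemma nth_insert_pair:
  assumes "j \<le> length w"
  shows "insert_pair N j w ! i =
    (if i < j then w ! i else if i < j + 2 then N else w ! (i - 2))"
proof (cases "i < j + 2")
  case True
  then have "i < j \<or> i = j \<or> i = Suc j" by auto
  then show ?thesis using assms by (auto simp: insert_pair_def nth_append min_def)
next
  case False
  then obtain m where "i = j + 2 + m" by (metis le_Suc_ex not_less)
  then show ?thesis using assms by (auto simp: insert_pair_def nth_append min_def)
qed

lemma length_insert_pair: "j \<le> length w \<Longrightarrow> length (insert_pair N j w) = length w + 2"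
  by (simp add: insert_pair_def)

text \<open>As a middle letter \<open>N\<close> meets the bound automatically, and its two adjacent
  copies have nothing between them. All other triples correspond under an order-preserving shift of
  positions.\<close>

lemma stirling_word_insert_pair_iff:
  assumes j: "j \<le> length w" and less: "\<And>x. x \<in> set w \<Longrightarrow> x < N"
  shows "stirling_word (insert_pair N j w) \<longleftrightarrow> stirling_word w"
proof
  let ?v = "insert_pair N j w"
  assume v: "stirling_word ?v"
  define up where "up i = (if i < j then i else i + 2)" for i
  have nth_up: "?v ! up i = w ! i" for i
    using j by (simp add: up_def nth_insert_pair)
  show "stirling_word w"
    unfolding stirling_word_def
  proof (intro allI impI, elim conjE)
    fix a b c assume abc: "a < b" "b < c" "c < length w" "w ! a = w ! c"
    have "up a < up b" "up b < up c" "up c < length ?v"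
      using abc j by (auto simp: up_def length_insert_pair)
    then show "w ! a \<le> w ! b"
      using v abc(4) unfolding stirling_word_def by (metis nth_up)
  qed
next
  let ?v = "insert_pair N j w"
  assume w: "stirling_word w"
  define down where "down i = (if i < j then i else i - 2)" for i :: nat
  define old where "old i \<longleftrightarrow> i < j \<or> j + 2 \<le> i" for i :: nat
  have nth_old: "?v ! i = w ! down i" if "old i" for i
    using that j by (auto simp: down_def old_def nth_insert_pair)
  have nth_new: "?v ! i = N" if "\<not> old i" for i
    using that j by (auto simp: old_def nth_insert_pair)
  have down_less: "down i < length w" if "old i" "i < length ?v" for i
    using that j by (auto simp: down_def old_def length_insert_pair)
  have mono: "down a < down b" if "old a" "old b" "a < b" for a b
    using that by (auto simp: down_def old_def)
  have below: "?v ! i < N" if "old i" "i < length ?v" for i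
    using nth_old[OF that(1)] down_less[OF that] less by simp
  show "stirling_word ?v"
    unfolding stirling_word_def
  proof (intro allI impI, elim conjE)
    fix a b c assume abc: "a < b" "b < c" "c < length ?v" "?v ! a = ?v ! c"
    \<comment> \<open>Equal letters put \<open>a\<close> and \<open>c\<close> both among the new
      positions or both among the old ones. The new positions are just \<open>j\<close> and
      \<open>j + 1\<close>, with no room for \<open>b\<close> between them.\<close>
    have old_a: "old a"
    proof (rule ccontr)
      assume a: "\<not> old a"
      then have "\<not> old c" using abc below[of c] nth_new[of a] by auto
      with a abc show False by (auto simp: old_def)
    qed
    then have old_c: "old c" using abc below[of a] nth_new[of c] by auto
    show "?v ! a \<le> ?v ! b"
    proof (cases "old b")
      case True
      have "w ! down a \<le> w ! down b"
        using w mono[OF old_a True abc(1)] mono[OF True old_c abc(2)] down_less[OF old_c abc(3)]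
          abc(4) nth_old[OF old_a] nth_old[OF old_c]
        unfolding stirling_word_def by metis
      then show ?thesis using nth_old old_a True by simp
    next
      case False
      then show ?thesis using nth_new[of b] below[OF old_a] abc by simp
    qed
  qed
qed

lemma stirling_mset_Suc:
  "mset_set {1..Suc n} + mset_set {1..Suc n} =
     mset_set {1..n} + mset_set {1..n} + {#Suc n, Suc n#}"
  by (simp add: atLeastAtMostSuc_conv)

lemma insert_pair_in_stirling_perms:
  assumes "j \<le> length w"
  shows "insert_pair (Suc n) j w \<in> stirling_perms (Suc n) \<longleftrightarrow> w \<in> stirling_perms n"
proof -
  have "mset (insert_pair (Suc n) j w) = mset_set {1..Suc n} + mset_set {1..Suc n}
      \<longleftrightarrow> mset w = mset_set {1..n} + mset_set {1..n}"
    unfolding mset_insert_pair stirling_mset_Suc by simp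
  moreover have "stirling_word (insert_pair (Suc n) j w) \<longleftrightarrow> stirling_word w"
    if m: "mset w = mset_set {1..n} + mset_set {1..n}"
  proof (rule stirling_word_insert_pair_iff[OF assms])
    fix x assume "x \<in> set w"
    then have "x \<in># mset_set {1..n} + mset_set {1..n}" by (metis m set_mset_mset)
    then show "x < Suc n" by auto
  qed
  ultimately show ?thesis unfolding stirling_perms_iff by blast
qed

text \<open>No letter exceeds the largest one, so its two copies must be adjacent.\<close>

lemma stirling_perm_Suc_obtain_pair:
  assumes v: "v \<in> stirling_perms (Suc n)"
  obtains j w where "j \<le> length w" "v = insert_pair (Suc n) j w"
proof -
  let ?N = "Suc n"
  have count: "count (mset v) ?N = 2" and st: "stirling_word v"
    using v unfolding stirling_perms_iff stirling_mset_Suc by auto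
  have le: "x \<le> ?N" if "x \<in> set v" for x
    using set_stirling_perm[OF v] that by simp
  have "?N \<in> set v" using set_stirling_perm[OF v] by simp
  \<comment> \<open>Splitting at first occurrences keeps \<open>Suc n\<close> out of
    \<open>us\<close>, and later out of \<open>zs\<close>; the count 2 then supplies the second
    copy.\<close>
  then obtain us ys where split: "v = us @ ?N # ys" "?N \<notin> set us"
    by (metis split_list_first)
  then have "count (mset ys) ?N = 1"
    using count by (simp add: count_mset_0_iff[THEN iffD2])
  then have "?N \<in> set ys" by (metis count_mset_0_iff zero_neq_one)
  then obtain zs vs where ys: "ys = zs @ ?N # vs" "?N \<notin> set zs"
    by (metis split_list_first)
  have "zs = []"
  proof (rule ccontr)
    assume "zs \<noteq> []"
    then obtain z zs' where zs: "zs = z # zs'" by (cases zs) auto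
    let ?a = "length us" and ?c = "length us + length zs + 1"
    have "v ! ?a = ?N" "v ! (?a + 1) = z" "v ! ?c = ?N" "?c < length v"
      using split ys zs by (auto simp: nth_append)
    moreover have "?a < ?a + 1" "?a + 1 < ?c" using zs by auto
    ultimately have "z \<ge> ?N" using st unfolding stirling_word_def by metis
    moreover have "z \<le> ?N" using le split ys zs by auto
    ultimately show False using ys zs by auto
  qed
  then have "v = insert_pair ?N (length us) (us @ vs)"
    using split ys by (simp add: insert_pair_def)
  then show thesis using that[of "length us" "us @ vs"] by simp
qed

text \<open>Deleting every \<open>N\<close> recovers the word, and the number of letters before the
  first \<open>N\<close> recovers the gap.\<close>

lemma inj_insert_pair:
  assumes "N \<notin> set w" "N \<notin> set w'" "j \<le> length w" "j' \<le> length w'"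
    and eq: "insert_pair N j w = insert_pair N j' w'"
  shows "w = w' \<and> j = j'"
proof -
  have filt: "filter (\<lambda>x. x \<noteq> N) (insert_pair N i u) = u" if "N \<notin> set u" for i u
  proof -
    have "filter (\<lambda>x. x \<noteq> N) (insert_pair N i u) = filter (\<lambda>x. x \<noteq> N) (take i u @ drop i u)"
      by (simp add: insert_pair_def del: append_take_drop_id)
    also have "\<dots> = u" unfolding append_take_drop_id filter_id_conv using that by blast
    finally show ?thesis .
  qed
  have tw: "length (takeWhile (\<lambda>x. x \<noteq> N) (insert_pair N i u)) = i"
    if "N \<notin> set u" "i \<le> length u" for i u
  proof -
    have "x \<noteq> N" if "x \<in> set (take i u)" for x
      using that \<open>N \<notin> set u\<close> by (meson in_set_takeD)
    then show ?thesis using that by (simp add: insert_pair_def takeWhile_append2)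
  qed
  show ?thesis using filt tw assms by metis
qed

lemma bij_betw_insert_pair:
  "bij_betw (\<lambda>(w, j). insert_pair (Suc n) j w)
     (stirling_perms n \<times> {..2 * n}) (stirling_perms (Suc n))"
proof (rule bij_betwI')
  fix x y assume "x \<in> stirling_perms n \<times> {..2 * n}" "y \<in> stirling_perms n \<times> {..2 * n}"
  then show "(case x of (w, j) \<Rightarrow> insert_pair (Suc n) j w) = (case y of (w, j) \<Rightarrow> insert_pair (Suc n) j w)
      \<longleftrightarrow> x = y"
    by (auto simp: length_stirling_perm set_stirling_perm dest!: inj_insert_pair[rotated -1])
next
  fix x assume "x \<in> stirling_perms n \<times> {..2 * n}"
  then show "(case x of (w, j) \<Rightarrow> insert_pair (Suc n) j w) \<in> stirling_perms (Suc n)"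
    by (auto simp: insert_pair_in_stirling_perms length_stirling_perm)
next
  fix v assume v: "v \<in> stirling_perms (Suc n)"
  then obtain j w where jw: "j \<le> length w" "v = insert_pair (Suc n) j w"
    by (rule stirling_perm_Suc_obtain_pair)
  with v have "w \<in> stirling_perms n" by (simp add: insert_pair_in_stirling_perms)
  with jw show "\<exists>x\<in>stirling_perms n \<times> {..2 * n}. v = (case x of (w, j) \<Rightarrow> insert_pair (Suc n) j w)"
    by (auto simp: length_stirling_perm intro!: bexI[of _ "(w, j)"])
qed

section \<open>Descents and their change under insertion\<close>

text \<open>Descents without padding: the recursive form splits over concatenation, and the boundary
  zeros of \<open>des\<close> are put in explicitly.\<close>

fun descents :: "'a::linorder list \<Rightarrow> nat" where
  "descents (x # y # zs) = (if x > y then 1 else 0) + descents (y # zs)"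
| "descents _ = 0"

lemma descents_append:
  "xs \<noteq> [] \<Longrightarrow> ys \<noteq> [] \<Longrightarrow>
     descents (xs @ ys) = descents xs + (if last xs > hd ys then 1 else 0) + descents ys"
proof (induction xs rule: descents.induct)
  case ("2_2" v)
  then show ?case by (cases ys) auto
qed auto

lemma descents_eq_card: "descents v = card {i. Suc i < length v \<and> v ! i > v ! Suc i}"
proof (induction v rule: descents.induct)
  case (1 x y zs)
  let ?A = "\<lambda>v. {i. Suc i < length v \<and> v ! i > v ! Suc i}"
  have fin: "finite (?A (y # zs))" by (rule finite_subset[of _ "{..<length (y # zs)}"]) auto
  have "?A (x # y # zs) = (if x > y then {0} else {}) \<union> Suc ` ?A (y # zs)"
  proof (rule set_eqI)
    fix i show "i \<in> ?A (x # y # zs) \<longleftrightarrow> i \<in> (if x > y then {0} else {}) \<union> Suc ` ?A (y # zs)"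
      by (cases i) auto
  qed
  then show ?case using 1 fin by (simp add: card_image card_insert_if)
qed auto

text \<open>Positions \<open>j\<close> and \<open>Suc j\<close> of the padded word are the
  neighbours of gap \<open>j\<close>, so descents are counted by gaps.\<close>

lemma des_eq_card: "des w = card {j \<in> {..length w}. (0 # w @ [0]) ! j > (0 # w @ [0]) ! Suc j}"
  by (simp add: des_def atLeast0AtMost)

lemma des_eq_descents: "des w = descents (0 # w @ [0])"
  unfolding des_eq_card descents_eq_card by (rule arg_cong[where f = card]) auto

text \<open>The pair adds an ascent, a plateau and one descent. The comparison across the gap is
  lost, so the total is unchanged exactly when that comparison was itself a descent.\<close>

lemma des_insert_pair:
  assumes j: "j \<le> length w" and less: "\<And>x. x \<in> set w \<Longrightarrow> x < N" and "0 < N"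
  shows "des (insert_pair N j w) =
    (if (0 # w @ [0]) ! j > (0 # w @ [0]) ! Suc j then des w else Suc (des w))"
proof -
  \<comment> \<open>The padding makes both parts nonempty even at the two outer gaps.\<close>
  let ?xs = "0 # take j w" and ?ys = "drop j w @ [0]"
  have split: "0 # w @ [0] = ?xs @ ?ys" by simp
  have last: "last ?xs = (0 # w @ [0]) ! j"
    using j by (cases j) (auto simp: last_conv_nth nth_append)
  have hd: "hd ?ys = (0 # w @ [0]) ! Suc j"
    using j by (cases "j = length w") (auto simp: hd_append hd_drop_conv_nth nth_append)
  have "set ?xs \<subseteq> insert 0 (set w)" "set ?ys \<subseteq> insert 0 (set w)"
    using set_take_subset[of j w] set_drop_subset[of j w] by auto
  then have "last ?xs \<in> insert 0 (set w)" "hd ?ys \<in> insert 0 (set w)"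
    using last_in_set[of ?xs] hd_in_set[of ?ys] by blast+
  then have below: "last ?xs < N" "hd ?ys < N"
    using less \<open>0 < N\<close> by auto
  have insert_max: "descents (xs @ [N, N] @ ys) = descents xs + 1 + descents ys"
    if "last xs < N" "hd ys < N" "xs \<noteq> []" "ys \<noteq> []" for xs ys
  proof -
    have "descents ([N, N] @ ys) = 1 + descents ys"
      using that by (subst descents_append) auto
    moreover have "descents (xs @ [N, N] @ ys) = descents xs + descents ([N, N] @ ys)"
      using that by (subst descents_append) auto
    ultimately show ?thesis by simp
  qed
  have "descents (?xs @ [N, N] @ ?ys) = descents ?xs + 1 + descents ?ys"
    by (rule insert_max[OF below]) simp_all
  moreover have "des (insert_pair N j w) = descents (?xs @ [N, N] @ ?ys)"
    by (simp add: des_eq_descents insert_pair_def)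
  moreover have "des w = descents ?xs + (if last ?xs > hd ?ys then 1 else 0) + descents ?ys"
    unfolding des_eq_descents split by (rule descents_append) auto
  ultimately show ?thesis unfolding last hd by simp
qed

lemma sum_insert_pair:
  assumes w: "w \<in> stirling_perms n"
  shows "(\<Sum>j\<le>2 * n. monom 1 (des (insert_pair (Suc n) j w))) = second_order_step n (monom 1 (des w))"
proof -
  let ?D = "{j \<in> {..2 * n}. (0 # w @ [0]) ! j > (0 # w @ [0]) ! Suc j}"
  have len: "length w = 2 * n" using w by (rule length_stirling_perm)
  have card: "card ?D = des w" by (simp add: des_eq_card len)
  have card_le: "card ?D \<le> 2 * n + 1"
    using card_mono[of "{..2 * n}" ?D] by auto
  have "card ({..2 * n} - ?D) = 2 * n + 1 - des w"
    by (subst card_Diff_subset) (simp_all only: card, auto)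
  \<comment> \<open>The bound on \<open>card ?D\<close> keeps the natural subtraction from
    truncating.\<close>
  then have card': "int (card ({..2 * n} - ?D)) = 2 * int n + 1 - int (des w)"
    using card card_le by linarith
  have "(\<Sum>j\<le>2 * n. monom (1::int) (des (insert_pair (Suc n) j w))) =
      (\<Sum>j\<le>2 * n. if j \<in> ?D then monom 1 (des w) else monom 1 (Suc (des w)))"
    by (rule sum.cong[OF refl], subst des_insert_pair)
       (use w in \<open>auto simp: len set_stirling_perm\<close>)
  also have "\<dots> = (\<Sum>j\<in>?D. monom 1 (des w)) + (\<Sum>j\<in>{..2 * n} - ?D. monom 1 (Suc (des w)))"
    by (subst sum.If_cases) (auto simp: Diff_eq Int_def intro!: arg_cong2[where f = "(+)"] sum.cong)
  also have "\<dots> = monom (int (des w)) (des w) + monom (2 * int n + 1 - int (des w)) (Suc (des w))"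
    using card card' by (simp add: of_nat_monom mult_monom)
  finally show ?thesis by (simp add: second_order_step_monom)
qed

lemma C_poly_Suc: "C_poly (Suc n) = second_order_step n (C_poly n)"
proof -
  have "C_poly (Suc n) =
      (\<Sum>(w, j)\<in>stirling_perms n \<times> {..2 * n}. monom 1 (des (insert_pair (Suc n) j w)))"
    unfolding C_poly_def sum.reindex_bij_betw[OF bij_betw_insert_pair, symmetric]
    by (rule sum.cong) auto
  also have "\<dots> = (\<Sum>w\<in>stirling_perms n. \<Sum>j\<le>2 * n. monom 1 (des (insert_pair (Suc n) j w)))"
    by (rule sum.cartesian_product[symmetric])
  also have "\<dots> = second_order_step n (C_poly n)"
    by (simp add: C_poly_def second_order_step_sum sum_insert_pair)
  finally show ?thesis .
qed


section \<open>Standard Young tableaux\<close>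

text \<open>The predicate describes a corner of the diagram at which a new largest entry may be
  appended to \<open>row\<close>; an empty \<open>row\<close> stands for starting a new row on top.\<close>

definition corner_split :: "'a list list \<Rightarrow> 'a list \<Rightarrow> 'a list list \<Rightarrow> bool" where
  "corner_split us row vs \<longleftrightarrow>
     (\<forall>u\<in>set us. length row < length u) \<and> (\<forall>v\<in>set vs. v \<noteq> [] \<and> length v \<le> length row)"

text \<open>Discards the empty \<open>row\<close> that encodes a new top row, so that lengthening a
  row and starting one are handled alike.\<close>

definition nonempty_rows :: "'a list list \<Rightarrow> 'a list list" where
  "nonempty_rows T = filter (\<lambda>r. r \<noteq> []) T"

text \<open>The entry joins the first row of length at most \<open>k\<close>. If \<open>k\<close> is
  a row length this is the lowest row of that length, and in a tableau without empty rows
  \<open>k = 0\<close> starts a new row.\<close>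

definition add_box :: "'a \<Rightarrow> nat \<Rightarrow> 'a list list \<Rightarrow> 'a list list" where
  "add_box N k T = takeWhile (\<lambda>r. k < length r) T @
     (case dropWhile (\<lambda>r. k < length r) T of [] \<Rightarrow> [[N]] | row # vs \<Rightarrow> (row @ [N]) # vs)"

section \<open>Rows, columns and order conditions at a corner\<close>

lemma column_append: "column k (S @ T) = column k S @ column k T"
  by (simp add: column_def)

lemma column_Cons: "column k (r # T) = (if k \<le> length r then [r ! (k - 1)] else []) @ column k T"
  by (simp add: column_def)

lemma column_nonempty_rows: "1 \<le> k \<Longrightarrow> column k (nonempty_rows T) = column k T"
  by (induction T) (auto simp: column_def nonempty_rows_def)

lemma set_column_subset:
  assumes "1 \<le> k"
  shows "set (column k T) \<subseteq> set (concat T)"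
proof
  fix x assume "x \<in> set (column k T)"
  then obtain r where r: "r \<in> set T" "k \<le> length r" "x = r ! (k - 1)"
    by (auto simp: column_def)
  with assms have "x \<in> set r" by simp
  with r show "x \<in> set (concat T)" by auto
qed

lemma concat_nonempty_rows: "concat (nonempty_rows T) = concat T"
  by (induction T) (auto simp: nonempty_rows_def)

lemma nonempty_rows_append: "nonempty_rows (S @ T) = nonempty_rows S @ nonempty_rows T"
  by (simp add: nonempty_rows_def)

text \<open>Rows in \<open>vs\<close> are nonempty and at most as long as \<open>row\<close>, so an
  empty \<open>row\<close> forces \<open>vs\<close> to be empty.\<close>

lemma nonempty_rows_corner:
  assumes "corner_split us row vs"
  shows "nonempty_rows (us @ row # vs) = us @ (if row = [] then [] else row # vs)"
proof -
  have "vs = []" if "row = []"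
    using assms that by (cases vs) (auto simp: corner_split_def)
  moreover have "nonempty_rows us = us" "nonempty_rows vs = vs"
    using assms by (auto simp: corner_split_def nonempty_rows_def filter_id_conv)
  ultimately show ?thesis by (auto simp: nonempty_rows_def)
qed

lemma nonempty_rows_map_filter:
  "nonempty_rows (map (filter P) (nonempty_rows T)) = nonempty_rows (map (filter P) T)"
  by (induction T) (auto simp: nonempty_rows_def)

lemma restrict_tab_alt: "restrict_tab i T = nonempty_rows (map (filter (\<lambda>e. e \<le> i)) T)"
  by (simp add: restrict_tab_def nonempty_rows_def)

text \<open>No row of \<open>vs\<close> reaches column \<open>Suc (length row)\<close>, so the new
  entry is the top of that column.\<close>

lemma column_corner:
  assumes "corner_split us row vs" "1 \<le> k"
  shows "column k (us @ (row @ [N]) # vs) =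
    column k (nonempty_rows (us @ row # vs)) @ (if k = Suc (length row) then [N] else [])"
proof -
  have "column (Suc (length row)) vs = []"
    using assms by (auto simp: column_def corner_split_def filter_empty_conv)
  then show ?thesis
    using assms(2) by (auto simp: column_nonempty_rows column_append column_Cons nth_append)
qed

lemma col_corner:
  assumes "corner_split us row vs" "1 \<le> k"
  shows "col k (us @ (row @ [N]) # vs) =
    col k (nonempty_rows (us @ row # vs)) + (if k = Suc (length row) then 1 else 0)"
  by (simp add: col_def column_corner[OF assms])

text \<open>The strict inequality for \<open>us\<close> leaves room for one more box in
  \<open>row\<close>, and lengthening \<open>row\<close> cannot violate its comparison with
  \<open>vs\<close>.\<close>

lemma shape_corner_sorted_iff:
  assumes "corner_split us row vs"
  shows "sorted_wrt (\<ge>) (shape (us @ (row @ [N]) # vs)) \<longleftrightarrow>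
    sorted_wrt (\<ge>) (shape (nonempty_rows (us @ row # vs)))"
proof (cases "row = []")
  case True
  then have "vs = []" using assms by (cases vs) (auto simp: corner_split_def)
  then show ?thesis
    using assms True unfolding nonempty_rows_corner[OF assms]
    by (auto simp: shape_def sorted_wrt_append corner_split_def Suc_le_eq)
next
  case False
  then show ?thesis
    using assms unfolding nonempty_rows_corner[OF assms]
    by (auto simp: shape_def sorted_wrt_append corner_split_def Suc_le_eq less_imp_le le_SucI)
qed

text \<open>The new entry exceeds all others and ends both its row and its column, so no order
  condition is affected.\<close>

lemma SYT_corner_iff:
  assumes corner: "corner_split us row vs"
  shows "us @ (row @ [Suc n]) # vs \<in> SYT (Suc n) \<longleftrightarrow> nonempty_rows (us @ row # vs) \<in> SYT n"
    (is "?T' \<in> _ \<longleftrightarrow> ?T \<in> _")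
proof -
  let ?N = "Suc n"
  have sets: "set (concat ?T') = insert ?N (set (concat ?T))"
    unfolding concat_nonempty_rows by auto
  have dist: "distinct (concat ?T') \<longleftrightarrow> distinct (concat ?T) \<and> ?N \<notin> set (concat ?T)"
    unfolding concat_nonempty_rows by auto
  have contents: "distinct (concat ?T') \<and> set (concat ?T') = {1..?N} \<longleftrightarrow>
      distinct (concat ?T) \<and> set (concat ?T) = {1..n}"
  proof -
    have "{1..?N} = insert ?N {1..n}" "?N \<notin> {1..n}" by auto
    then show ?thesis unfolding sets dist by (metis insert_ident)
  qed
  have rows: "\<forall>r\<in>set ?T'. r \<noteq> []" "\<forall>r\<in>set ?T. r \<noteq> []"
    using corner by (auto simp: corner_split_def nonempty_rows_def)
  have increasing: "(\<forall>r\<in>set ?T'. sorted_wrt (<) r) \<longleftrightarrow> (\<forall>r\<in>set ?T. sorted_wrt (<) r)"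
    "(\<forall>k\<ge>1. sorted_wrt (<) (column k ?T')) \<longleftrightarrow> (\<forall>k\<ge>1. sorted_wrt (<) (column k ?T))"
    if "set (concat ?T) = {1..n}"
  proof -
    have less: "x < ?N" if "x \<in> set (concat ?T)" for x
      using that unfolding \<open>set (concat ?T) = {1..n}\<close> by simp
    have "sorted_wrt (<) (row @ [?N]) \<longleftrightarrow> sorted_wrt (<) row"
      using less unfolding concat_nonempty_rows by (auto simp: sorted_wrt_append)
    then show "(\<forall>r\<in>set ?T'. sorted_wrt (<) r) \<longleftrightarrow> (\<forall>r\<in>set ?T. sorted_wrt (<) r)"
      by (auto simp: nonempty_rows_def)
    have "sorted_wrt (<) (column k ?T') \<longleftrightarrow> sorted_wrt (<) (column k ?T)" if "1 \<le> k" for k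
      using set_column_subset[OF that, of ?T] less
      by (auto simp: column_corner[OF corner that] sorted_wrt_append)
    then show "(\<forall>k\<ge>1. sorted_wrt (<) (column k ?T')) \<longleftrightarrow> (\<forall>k\<ge>1. sorted_wrt (<) (column k ?T))"
      by simp
  qed
  show ?thesis
  \<comment> \<open>The order conditions can be compared only when the old entries are bounded by
    \<open>n\<close>; otherwise the entries already rule out both memberships.\<close>
  proof (cases "set (concat ?T) = {1..n}")
    case True
    show ?thesis
      unfolding SYT_def mem_Collect_eq shape_corner_sorted_iff[OF corner] increasing[OF True]
      using contents rows by argo
  next
    case False
    then show ?thesis unfolding SYT_def mem_Collect_eq using contents by argo
  qed
qed

section \<open>Corners and the largest entry\<close>

lemma SYT_Suc_obtain_corner:
  assumes T': "T' \<in> SYT (Suc n)"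
  obtains us row vs where "corner_split us row vs" "T' = us @ (row @ [Suc n]) # vs"
proof -
  let ?N = "Suc n"
  have ne: "\<And>r. r \<in> set T' \<Longrightarrow> r \<noteq> []" and sorted: "sorted_wrt (\<ge>) (shape T')"
    and contents: "distinct (concat T')" "set (concat T') = {1..?N}"
    and rows: "\<And>r. r \<in> set T' \<Longrightarrow> sorted_wrt (<) r"
    and cols: "\<And>k. 1 \<le> k \<Longrightarrow> sorted_wrt (<) (column k T')"
    using T' unfolding SYT_def by auto
  have le: "x \<le> ?N" if "x \<in> set (concat T')" for x
    using that unfolding contents(2) by simp
  have "?N \<in> set (concat T')" using contents(2) by simp
  then obtain r where r: "r \<in> set T'" "?N \<in> set r" by auto
  obtain us vs where split: "T' = us @ r # vs" using split_list[OF r(1)] by blast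
  obtain row ys where row: "r = row @ ?N # ys" using split_list[OF r(2)] by blast
  have "ys = []"
  proof (cases ys)
    case (Cons y ys')
    then have "?N < y" using rows[OF r(1)] row by (auto simp: sorted_wrt_append)
    moreover have "y \<le> ?N" using le split row Cons by auto
    ultimately show ?thesis by simp
  qed simp
  with row have row: "r = row @ [?N]" by simp
  \<comment> \<open>Rows of \<open>us\<close> are at least as long as \<open>row @ [?N]\<close>,
    which gives the strict inequality for \<open>row\<close>.\<close>
  have "length row < length u" if "u \<in> set us" for u
    using sorted split row that by (auto simp: shape_def sorted_wrt_append Suc_le_eq)
  moreover have "v \<noteq> [] \<and> length v \<le> length row" if v: "v \<in> set vs" for v
  proof (intro conjI)
    show "v \<noteq> []" using ne split v by simp
    show "length v \<le> length row"
    \<comment> \<open>A row above reaching the column of \<open>?N\<close> would hold there an entry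
      larger than \<open>?N\<close>.\<close>
    proof (rule ccontr)
      assume len: "\<not> length v \<le> length row"
      let ?k = "Suc (length row)"
      have "v ! length row \<in> set (column ?k vs)"
        using len v by (force simp: column_def)
      moreover have "column ?k T' = column ?k us @ ?N # column ?k vs"
        by (simp add: split row column_append column_Cons)
      ultimately have "?N < v ! length row"
        using cols[of ?k] by (auto simp: sorted_wrt_append)
      moreover have "v ! length row \<in> set (concat T')"
        using len v split by (auto intro!: bexI[of _ v])
      ultimately show False using le by force
    qed
  qed
  ultimately show thesis
    using that[of us row vs] split row by (simp add: corner_split_def)
qed

text \<open>Every row of \<open>us\<close> is longer than \<open>row\<close>, so the search in
  \<open>add_box\<close> stops exactly at \<open>row\<close>, or passes the top when
  \<open>row\<close> is empty.\<close>

lemma add_box_corner: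
  assumes "corner_split us row vs"
  shows "add_box N (length row) (nonempty_rows (us @ row # vs)) = us @ (row @ [N]) # vs"
proof (cases "row = []")
  case True
  then have "vs = []" using assms by (cases vs) (auto simp: corner_split_def)
  have "takeWhile (\<lambda>r. r \<noteq> []) us = us" "dropWhile (\<lambda>r. r \<noteq> []) us = []"
    using assms True by (auto simp: corner_split_def takeWhile_eq_all_conv dropWhile_eq_Nil_conv)
  note whole = this
  show ?thesis
    unfolding nonempty_rows_corner[OF assms] using True \<open>vs = []\<close> by (simp add: add_box_def whole)
next
  case False
  then show ?thesis
    unfolding nonempty_rows_corner[OF assms]
    using assms by (simp add: add_box_def corner_split_def takeWhile_append2 dropWhile_append2)
qed

lemma obtain_corner_split:
  assumes T: "T \<in> SYT n" and k: "k \<in> insert 0 (set (shape T))"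
  obtains us row vs where "corner_split us row vs" "k = length row" "T = nonempty_rows (us @ row # vs)"
proof -
  let ?P = "\<lambda>r. k < length (r :: nat list)"
  have ne: "\<And>r. r \<in> set T \<Longrightarrow> r \<noteq> []" and sorted: "sorted_wrt (\<ge>) (shape T)"
    using T unfolding SYT_def by auto
  let ?us = "takeWhile ?P T"
  have us: "\<forall>u\<in>set ?us. k < length u" by (auto dest: set_takeWhileD)
  show thesis
  proof (cases "dropWhile ?P T")
    case Nil
    then have eq: "?us = T" by (metis append_Nil2 takeWhile_dropWhile_id)
    \<comment> \<open>Every row is longer than \<open>k\<close> here, so \<open>k\<close> is not a
      row length.\<close>
    then have "k = 0" using us k by (auto simp: shape_def)
    moreover have "nonempty_rows T = T" using ne by (simp add: nonempty_rows_def filter_id_conv)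
    ultimately show thesis
      using that[of T "[]" "[]"] us eq
      by (simp add: corner_split_def nonempty_rows_append) (simp add: nonempty_rows_def)
  next
    case (Cons row vs)
    then have split: "T = ?us @ row # vs" by (metis takeWhile_dropWhile_id)
    \<comment> \<open>The first row not longer than \<open>k\<close> is the longest of the remaining
      ones, and these include a row of length \<open>k\<close>; hence its length is
      \<open>k\<close>.\<close>
    have "length row \<le> k" using hd_dropWhile[of ?P T] Cons by auto
    moreover have "row \<noteq> []" using ne split by (metis in_set_conv_decomp)
    ultimately have "k \<in> set (shape T)" using k by auto
    then obtain r where r: "r \<in> set T" "k = length r" by (auto simp: shape_def)
    with us have "r \<in> set (row # vs)" using split by (metis Un_iff less_irrefl set_append)
    moreover have above: "\<forall>v\<in>set vs. length v \<le> length row"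
      using sorted by (subst (asm) split) (auto simp: shape_def sorted_wrt_append)
    ultimately have k: "k = length row" using r \<open>length row \<le> k\<close> by auto
    have "\<forall>v\<in>set vs. v \<noteq> []" using ne split by (metis Un_iff list.set_intros(2) set_append)
    then have corner: "corner_split ?us row vs" using us above k by (auto simp: corner_split_def)
    moreover have "T = nonempty_rows (?us @ row # vs)"
      using nonempty_rows_corner[OF corner] split \<open>row \<noteq> []\<close> by simp
    ultimately show thesis using that k by blast
  qed
qed

section \<open>Restriction and the columns of entries\<close>

lemma restrict_tab_SYT:
  assumes "T \<in> SYT n" "n \<le> m"
  shows "restrict_tab m T = T"
proof -
  have "filter (\<lambda>e. e \<le> m) r = r" if "r \<in> set T" for r
  proof -
    have "set r \<subseteq> {1..n}" using assms(1) that unfolding SYT_def by auto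
    with assms(2) show ?thesis by (auto simp: filter_id_conv)
  qed
  then have "map (filter (\<lambda>e. e \<le> m)) T = T" by (simp add: map_idI)
  moreover have "filter (\<lambda>r. r \<noteq> []) T = T" using assms(1) by (simp add: SYT_def filter_id_conv)
  ultimately show ?thesis by (simp add: restrict_tab_def)
qed

lemma restrict_tab_corner:
  assumes "i < N"
  shows "restrict_tab i (us @ (row @ [N]) # vs) = restrict_tab i (nonempty_rows (us @ row # vs))"
  using assms unfolding restrict_tab_alt nonempty_rows_map_filter by simp

lemma not_in_column_SYT: "T \<in> SYT n \<Longrightarrow> 1 \<le> k \<Longrightarrow> n < x \<Longrightarrow> x \<notin> set (column k T)"
  using set_column_subset[of k T] by (auto simp: SYT_def)

text \<open>No column of the smaller tableau contains \<open>N\<close>, so the added box alone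
  determines the definite description.\<close>

lemma col_of_corner_new:
  assumes "corner_split us row vs" and T: "nonempty_rows (us @ row # vs) \<in> SYT n" and "n < N"
  shows "col_of (us @ (row @ [N]) # vs) N = Suc (length row)"
proof -
  have "k \<ge> 1 \<and> N \<in> set (column k (us @ (row @ [N]) # vs)) \<longleftrightarrow> k = Suc (length row)" for k
    using not_in_column_SYT[OF T, of k N] assms(3) by (auto simp: column_corner[OF assms(1)])
  then show ?thesis by (simp add: col_of_def)
qed

lemma col_of_corner_old:
  assumes "corner_split us row vs" "i \<noteq> N"
  shows "col_of (us @ (row @ [N]) # vs) i = col_of (nonempty_rows (us @ row # vs)) i"
proof -
  have "(\<lambda>k. k \<ge> 1 \<and> i \<in> set (column k (us @ (row @ [N]) # vs))) =
      (\<lambda>k. k \<ge> 1 \<and> i \<in> set (column k (nonempty_rows (us @ row # vs))))"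
    using assms(2) by (auto simp: column_corner[OF assms(1)] fun_eq_iff)
  then show ?thesis by (simp only: col_of_def)
qed

section \<open>Tableaux with one more box as tableaux with a chosen corner\<close>

lemma bij_betw_add_box:
  "bij_betw (\<lambda>(T, k). add_box (Suc n) k T) (SIGMA T:SYT n. insert 0 (set (shape T))) (SYT (Suc n))"
proof -
  let ?S = "SIGMA T:SYT n. insert 0 (set (shape T))"
  let ?f = "\<lambda>(T, k). add_box (Suc n) k T"
  \<comment> \<open>The inverse deletes the largest entry. That entry ends a row whose former length
    is its column number minus one.\<close>
  let ?g = "\<lambda>T'. (restrict_tab n T', col_of T' (Suc n) - 1)"
  have fwd: "?f x \<in> SYT (Suc n) \<and> ?g (?f x) = x" if x: "x \<in> ?S" for x
  proof -
    obtain T k where Tk: "x = (T, k)" "T \<in> SYT n" "k \<in> insert 0 (set (shape T))"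
      using x by auto
    obtain us row vs where split: "corner_split us row vs" "k = length row"
        "T = nonempty_rows (us @ row # vs)"
      using obtain_corner_split[OF Tk(2,3)] .
    have T: "nonempty_rows (us @ row # vs) \<in> SYT n" using Tk(2) split(3) by simp
    have "?f x = us @ (row @ [Suc n]) # vs"
      using Tk(1) split add_box_corner[OF split(1)] by simp
    then show ?thesis
      using Tk(1) split(2,3) T SYT_corner_iff[OF split(1)] col_of_corner_new[OF split(1) T]
        restrict_tab_SYT[OF T] by (simp add: restrict_tab_corner)
  qed
  have bwd: "\<exists>x\<in>?S. T' = ?f x" if T': "T' \<in> SYT (Suc n)" for T'
  proof -
    obtain us row vs where split: "corner_split us row vs" "T' = us @ (row @ [Suc n]) # vs"
      using SYT_Suc_obtain_corner[OF T'] .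
    let ?T = "nonempty_rows (us @ row # vs)"
    have "?T \<in> SYT n" using T' split SYT_corner_iff by blast
    moreover have "length row \<in> insert 0 (set (shape ?T))"
      unfolding nonempty_rows_corner[OF split(1)] by (simp add: shape_def)
    ultimately have "(?T, length row) \<in> ?S" by blast
    moreover have "T' = ?f (?T, length row)" using split(2) add_box_corner[OF split(1), of "Suc n"] by simp
    ultimately show ?thesis by blast
  qed
  show ?thesis
  proof (rule bij_betwI')
    show "?f x = ?f y \<longleftrightarrow> x = y" if "x \<in> ?S" "y \<in> ?S" for x y
      using fwd that by metis
    show "?f x \<in> SYT (Suc n)" if "x \<in> ?S" for x using fwd that by blast
    show "\<exists>x\<in>?S. T' = ?f x" if "T' \<in> SYT (Suc n)" for T' by (rule bwd[OF that])
  qed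
qed

section \<open>Weights and the recurrence for tableaux\<close>

definition tableau_weight :: "nat \<Rightarrow> tableau \<Rightarrow> int" where
  "tableau_weight n T = (\<Prod>i=1..n. sigma i T * fact i ^ w_rows i T)"

lemma prod_power_count_list:
  fixes f :: "'a \<Rightarrow> 'b::comm_monoid_mult"
  assumes "finite A" "set xs \<subseteq> A"
  shows "(\<Prod>i\<in>A. f i ^ count_list xs i) = prod_list (map f xs)"
  using assms(2)
proof (induction xs)
  case (Cons x xs)
  have "(\<Prod>i\<in>A. f i ^ count_list (x # xs) i) =
      (\<Prod>i\<in>A. (if i = x then f i else 1) * f i ^ count_list xs i)"
    by (rule prod.cong) auto
  also have "\<dots> = f x * (\<Prod>i\<in>A. f i ^ count_list xs i)"
    using assms(1) Cons.prems by (simp add: prod.distrib prod.delta)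
  finally show ?case using Cons by simp
qed simp

text \<open>With one factorial per row instead of powers indexed by row length, lengthening a row
  changes a single factor, from \<open>k!\<close> to \<open>(k + 1)!\<close>.\<close>

lemma tableau_weight_alt:
  assumes T: "T \<in> SYT n"
  shows "tableau_weight n T = (\<Prod>i=1..n. sigma i T) * prod_list (map fact (shape T))"
proof -
  have "length r \<in> {1..n}" if "r \<in> set T" for r
  proof -
    have "length r \<le> length (concat T)"
      unfolding length_concat using that by (simp add: member_le_sum_list)
    then show ?thesis
      using T that length_le_of_SYT(1)[OF T] by (auto simp: SYT_def Suc_le_eq)
  qed
  then have "set (shape T) \<subseteq> {1..n}" by (auto simp: shape_def)
  then show ?thesis
    unfolding tableau_weight_def w_rows_def prod.distrib
    by (subst prod_power_count_list) auto
qed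

text \<open>A row that reaches column \<open>k\<close> but not column \<open>Suc k\<close> has
  exactly \<open>k\<close> boxes. This turns the column differences in \<open>sigma\<close> into row
  counts.\<close>

lemma col_eq_col_Suc: "col k T = col (Suc k) T + count_list (shape T) k"
  by (induction T) (auto simp: col_def column_def shape_def)

lemma col_one_SYT: "T \<in> SYT n \<Longrightarrow> col 1 T = length T"
  by (auto simp: col_def column_def SYT_def Suc_le_eq filter_id_conv intro!: arg_cong[where f = length])

text \<open>The factors \<open>sigma i\<close> with \<open>i \<le> n\<close> see only the tableau
  restricted to \<open>i\<close> and the column of \<open>i\<close>, so they survive. Only the new
  \<open>sigma\<close> and one factorial contribute.\<close>

lemma tableau_weight_corner:
  assumes corner: "corner_split us row vs" and T: "nonempty_rows (us @ row # vs) \<in> SYT n"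
  defines "T \<equiv> nonempty_rows (us @ row # vs)"
  shows "tableau_weight (Suc n) (us @ (row @ [Suc n]) # vs) = tableau_weight n T *
    ((if row = [] then int (Suc n) - int (length T) else int (count_list (shape T) (length row)))
      * int (Suc (length row)))"
proof -
  let ?N = "Suc n" and ?T' = "us @ (row @ [Suc n]) # vs"
  have T': "?T' \<in> SYT ?N" using SYT_corner_iff[OF corner] T by blast
  have old: "sigma i ?T' = sigma i T" if "i \<in> {1..n}" for i
    using that by (simp add: sigma_def T_def col_of_corner_old[OF corner] restrict_tab_corner)
  \<comment> \<open>The \<open>+ 1\<close> in \<open>sigma\<close> cancels the box just added to the
    subtracted column.\<close>
  have new: "sigma ?N ?T' =
      (if row = [] then int ?N - int (length T) else int (count_list (shape T) (length row)))"
  proof -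
    define S where "S = ?T'"
    have restrict: "restrict_tab ?N S = S"
      unfolding S_def using restrict_tab_SYT[OF T'] by simp
    have place: "col_of S ?N = Suc (length row)"
      unfolding S_def using col_of_corner_new[OF corner T] by simp
    have col: "col k S = col k T + (if k = Suc (length row) then 1 else 0)" if "1 \<le> k" for k
      unfolding S_def T_def using col_corner[OF corner that] .
    have "sigma ?N S = (if row = [] then int ?N - int (length T)
        else int (count_list (shape T) (length row)))"
    proof (cases "row = []")
      case True
      then show ?thesis
        using col[of 1] col_one_SYT[OF T] by (simp add: sigma_def restrict place T_def)
    next
      case False
      then have "1 \<le> length row" by (simp add: Suc_le_eq)
      then show ?thesis
        using False col[of "length row"] col[of "Suc (length row)"] col_eq_col_Suc[of "length row" T]
        by (simp add: sigma_def restrict place)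
    qed
    then show ?thesis by (simp only: S_def)
  qed
  \<comment> \<open>A new row brings the factor \<open>1! = 1\<close>, which agrees with
    \<open>Suc (length row)\<close> for an empty \<open>row\<close>.\<close>
  have "prod_list (map fact (shape ?T')) = (prod_list (map fact (shape T)) * int (Suc (length row)))"
    unfolding T_def nonempty_rows_corner[OF corner] using corner
    by (cases vs) (auto simp: shape_def corner_split_def algebra_simps)
  moreover have "(\<Prod>i=1..n. sigma i ?T') = (\<Prod>i=1..n. sigma i T)"
    using old by (intro prod.cong) auto
  ultimately show ?thesis
    using tableau_weight_alt[OF T'] tableau_weight_alt[OF T] new T_def
    by (simp add: algebra_simps)
qed

definition tableau_poly :: "nat \<Rightarrow> int poly" where
  "tableau_poly n = (\<Sum>T\<in>SYT n. monom (tableau_weight n T) (n + 1 - length (shape T)))"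

text \<open>Rows of equal length share one corner. The new \<open>sigma\<close> equals their number,
  so the sum over distinct lengths becomes a sum over all rows.\<close>

lemma sum_add_box:
  assumes T: "T \<in> SYT n"
  shows "(\<Sum>k\<in>insert 0 (set (shape T)). monom (tableau_weight (Suc n) (add_box (Suc n) k T))
      (Suc n + 1 - length (shape (add_box (Suc n) k T)))) =
    second_order_step n (monom (tableau_weight n T) (n + 1 - length (shape T)))"
proof -
  let ?w = "tableau_weight n T" and ?l = "length T"
  let ?g = "\<lambda>k. monom (tableau_weight (Suc n) (add_box (Suc n) k T))
      (Suc n + 1 - length (shape (add_box (Suc n) k T)))"
  have l: "?l \<le> n" using length_le_of_SYT[OF T] by simp
  have 0: "0 \<notin> set (shape T)" using T by (auto simp: SYT_def shape_def)
  \<comment> \<open>A new row raises the size and the number of rows together, keeping the exponent;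
    a longer row raises only the size.\<close>
  have g: "?g k = (if k = 0 then monom (?w * (int (Suc n) - int ?l)) (n + 1 - ?l)
      else monom (?w * int (count_list (shape T) k * Suc k)) (Suc (n + 1 - ?l)))"
    if k: "k \<in> insert 0 (set (shape T))" for k
  proof -
    obtain us row vs where split: "corner_split us row vs" "k = length row"
        "T = nonempty_rows (us @ row # vs)"
      using obtain_corner_split[OF T k] .
    have add: "add_box (Suc n) k T = us @ (row @ [Suc n]) # vs"
      using split add_box_corner by simp
    have "length (us @ (row @ [Suc n]) # vs) = ?l + (if row = [] then 1 else 0)"
      unfolding split(3) nonempty_rows_corner[OF split(1)] using split(1)
      by (cases vs) (auto simp: corner_split_def)
    moreover have "tableau_weight (Suc n) (us @ (row @ [Suc n]) # vs) = ?w *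
        ((if row = [] then int (Suc n) - int ?l else int (count_list (shape T) (length row)))
          * int (Suc (length row)))"
      using tableau_weight_corner[OF split(1)] T split(3) by simp
    ultimately show ?thesis
      using l unfolding add by (auto simp: split(2) shape_def Suc_diff_le algebra_simps)
  qed
  have "(\<Sum>k\<in>set (shape T). count_list (shape T) k * Suc k) = (\<Sum>k\<leftarrow>shape T. Suc k)"
    by (rule sum_list_map_eq_sum_count[symmetric])
  also have "\<dots> = length (concat T) + ?l"
    unfolding shape_def by (induction T) auto
  finally have boxes: "(\<Sum>k\<in>set (shape T). count_list (shape T) k * Suc k) = n + ?l"
    using length_le_of_SYT(1)[OF T] by simp
  have "(\<Sum>k\<in>insert 0 (set (shape T)). ?g k) = ?g 0 + (\<Sum>k\<in>set (shape T). ?g k)"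
    using 0 by simp
  also have "?g 0 = monom (?w * (int (Suc n) - int ?l)) (n + 1 - ?l)"
    using g[of 0] by simp
  also have "(\<Sum>k\<in>set (shape T). ?g k) =
      (\<Sum>k\<in>set (shape T). monom (?w * int (count_list (shape T) k * Suc k)) (Suc (n + 1 - ?l)))"
    using g 0 by (intro sum.cong) auto
  also have "\<dots> = monom (?w * int (n + ?l)) (Suc (n + 1 - ?l))"
    unfolding boxes[symmetric] of_nat_sum sum_distrib_left monom_sum ..
  \<comment> \<open>For \<open>p = n + 1 - ?l\<close> the two coefficients are \<open>p\<close> and
    \<open>2 * n + 1 - p = n + ?l\<close>.\<close>
  finally show ?thesis
    using l by (simp add: second_order_step_monom shape_def of_nat_diff algebra_simps)
qed

lemma tableau_poly_Suc: "tableau_poly (Suc n) = second_order_step n (tableau_poly n)"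
proof -
  have "tableau_poly (Suc n) = (\<Sum>(T, k)\<in>(SIGMA T:SYT n. insert 0 (set (shape T))).
      monom (tableau_weight (Suc n) (add_box (Suc n) k T))
        (Suc n + 1 - length (shape (add_box (Suc n) k T))))"
    unfolding tableau_poly_def sum.reindex_bij_betw[OF bij_betw_add_box, symmetric]
    by (rule sum.cong) auto
  also have "\<dots> = (\<Sum>T\<in>SYT n. \<Sum>k\<in>insert 0 (set (shape T)).
      monom (tableau_weight (Suc n) (add_box (Suc n) k T))
        (Suc n + 1 - length (shape (add_box (Suc n) k T))))"
    by (rule sum.Sigma[symmetric]) (auto simp: finite_SYT)
  also have "\<dots> = (\<Sum>T\<in>SYT n. second_order_step n (monom (tableau_weight n T) (n + 1 - length (shape T))))"
    by (intro sum.cong refl sum_add_box)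
  finally show ?thesis by (simp add: tableau_poly_def second_order_step_sum)
qed

section \<open>Initial values and conclusion\<close>

lemma C_poly_0: "C_poly 0 = 1"
proof -
  have "stirling_perms 0 = {[]}" by (auto simp: stirling_perms_iff stirling_word_def)
  then show ?thesis by (simp add: C_poly_def des_eq_descents)
qed

lemma tableau_poly_0: "tableau_poly 0 = monom 1 1"
proof -
  have "SYT 0 = {[]}" by (auto simp: SYT_def shape_def column_def)
  then show ?thesis by (simp add: tableau_poly_def tableau_weight_def shape_def)
qed

theorem theorem4p8:
  fixes n :: nat
  assumes "n \<ge> 1"
  shows "C_poly n = (\<Sum>T\<in>SYT n.
           monom (\<Prod>i=1..n. sigma i T * (fact i) ^ (w_rows i T)) (n + 1 - length (shape T)))"
proof -
  have "C_poly n = tableau_poly n"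
    using assms
  proof (induction n rule: dec_induct)
    case base
    \<comment> \<open>The sides differ at 0, being \<open>1\<close> and \<open>x\<close>, but
      \<open>second_order_step 0\<close> sends both to \<open>x\<close>; so they agree from 1
      on.\<close>
    have "C_poly (Suc 0) = tableau_poly (Suc 0)"
      unfolding C_poly_Suc tableau_poly_Suc C_poly_0 tableau_poly_0
      by (simp add: second_order_step_monom flip: monom_eq_1)
    then show ?case by simp
  next
    case (step n)
    then show ?case by (simp add: C_poly_Suc tableau_poly_Suc)
  qed
  then show ?thesis by (simp add: tableau_poly_def tableau_weight_def)
qed

end
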